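(* Let $\mathsf{M}$ be an elementary split matroid of rank $k$ and cardinality $n$. For each $r,h$ let $\lambda_{r,h}$ denote the number of stressed subsets of $\mathsf{M}$ with non-empty cover of rank $r$ and size $h$. Then the Tutte polynomial of $\mathsf{M}$ is given by \[ T_{\mathsf{M}}(x,y) = T_{\mathsf{U}_{k,n}}(x,y) - \sum_{r,h}\lambda_{r,h}\sum_{i=r+1}^{h}\sum_{j=0}^{k-r-1}\binom{h}{i}\binom{n-h}{j}\,\alpha_{r,k}^{i,j}(x,y),\] where \[\alpha_{r,k}^{i,j}(x,y)=\begin{cases}(x-1)^{k-i-j}\left(1-((x-1)(y-1))^{i-r}\right) & \text{if } i+j\le k,\\ (y-1)^{i+j-k}\left(1-((x-1)(y-1))^{k-r-j}\right) & \text{if } i+j>k.\end{cases}\]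
   Context: $\mathsf{U}_{k,n}$ is the uniform matroid of rank $k$ on $n$ elements. The Tutte polynomial of a matroid $\mathsf{M}$ on $E$ with rank function $\operatorname{rk}$ is $T_{\mathsf{M}}(x,y)=\sum_{A\subseteq E}(x-1)^{\operatorname{rk}(E)-\operatorname{rk}(A)}(y-1)^{|A|-\operatorname{rk}(A)}$. Let $\mathsf{M}$ be a matroid on $E$ of rank $k$. A subset $A\subseteq E$ is stressed if both $\mathsf{M}|_A$ and $\mathsf{M}/A$ are uniform. The cover of $A$ is $\operatorname{cover}(A)=\{S\subseteq E: |S|=k,\ |S\cap A|\ge \operatorname{rk}(A)+1\}$. Elementary split matroids: a matroid is connected if it is not a direct sum of two matroids with non-empty ground sets. For a connected matroid $\mathsf{M}$ on $E$, a flacet is a flat $F$ such that $\mathsf{M}|_F$ and $\mathsf{M}/F$ are connected; a flacet $F$ is a split flacet if $0<\operatorname{rk}(F)<|F|$ and $E\smallsetminus F$ contains at least one element that is not a coloop of $\mathsf{M}$. A connected split matroid is a connected matroid all of whose split flacets are stressed. A matroid is elementary split if it is either a connected split matroid or a direct sum of two uniform matroids. *)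

theory Defs
  imports "HOL-Computational_Algebra.Polynomial"
begin

text \<open>Finite matroids, given by their independent sets. All independent sets are subsets of the
  ground set, so two matroids are the same matroid iff the records are equal.\<close>

record 'a matroid =
  ground :: "'a set"
  indeps :: "'a set set"

definition is_matroid :: "'a matroid \<Rightarrow> bool" where
  "is_matroid M \<longleftrightarrow>
     finite (ground M) \<and>
     (\<forall>I\<in>indeps M. I \<subseteq> ground M) \<and>
     {} \<in> indeps M \<and>
     (\<forall>I\<in>indeps M. \<forall>J. J \<subseteq> I \<longrightarrow> J \<in> indeps M) \<and>
     (\<forall>I\<in>indeps M. \<forall>J\<in>indeps M. card I < card J \<longrightarrow> (\<exists>e\<in>J - I. insert e I \<in> indeps M))"

definition rk :: "'a matroid \<Rightarrow> 'a set \<Rightarrow> nat" where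
  "rk M A = Max (card ` {I \<in> indeps M. I \<subseteq> A})"

definition rank :: "'a matroid \<Rightarrow> nat" where
  "rank M = rk M (ground M)"

definition basis :: "'a matroid \<Rightarrow> 'a set \<Rightarrow> bool" where
  "basis M B \<longleftrightarrow> B \<in> indeps M \<and> (\<forall>I\<in>indeps M. B \<subseteq> I \<longrightarrow> I = B)"

definition coloop :: "'a matroid \<Rightarrow> 'a \<Rightarrow> bool" where
  "coloop M e \<longleftrightarrow> e \<in> ground M \<and> (\<forall>B. basis M B \<longrightarrow> e \<in> B)"

definition flat :: "'a matroid \<Rightarrow> 'a set \<Rightarrow> bool" where
  "flat M F \<longleftrightarrow> F \<subseteq> ground M \<and> (\<forall>e\<in>ground M - F. rk M F < rk M (insert e F))"

definition restriction :: "'a matroid \<Rightarrow> 'a set \<Rightarrow> 'a matroid" where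
  "restriction M A = \<lparr>ground = A, indeps = {I \<in> indeps M. I \<subseteq> A}\<rparr>"

text \<open>The rank function of the contraction is \<open>rk M (X \<union> A) - rk M A\<close>, and \<open>I\<close> is independent
  iff its rank equals its size.\<close>

definition contraction :: "'a matroid \<Rightarrow> 'a set \<Rightarrow> 'a matroid" where
  "contraction M A =
     \<lparr>ground = ground M - A,
      indeps = {I. I \<subseteq> ground M - A \<and> rk M (I \<union> A) = rk M A + card I}\<rparr>"

text \<open>Only meaningful for matroids with disjoint ground sets.\<close>

definition direct_sum :: "'a matroid \<Rightarrow> 'a matroid \<Rightarrow> 'a matroid" where
  "direct_sum M N =
     \<lparr>ground = ground M \<union> ground N,
      indeps = {I \<union> J | I J. I \<in> indeps M \<and> J \<in> indeps N}\<rparr>"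

definition uniform_on :: "nat \<Rightarrow> 'a set \<Rightarrow> 'a matroid" where
  "uniform_on k E = \<lparr>ground = E, indeps = {I. I \<subseteq> E \<and> card I \<le> k}\<rparr>"

text \<open>The matroid \<open>U\<^sub>k\<^sub>,\<^sub>n\<close>, for \<open>k \<le> n\<close>.\<close>

definition U :: "nat \<Rightarrow> nat \<Rightarrow> nat matroid" where
  "U k n = uniform_on k {..<n}"

definition uniform :: "'a matroid \<Rightarrow> bool" where
  "uniform M \<longleftrightarrow> is_matroid M \<and> (\<exists>k\<le>card (ground M). M = uniform_on k (ground M))"

definition connected :: "'a matroid \<Rightarrow> bool" where
  "connected M \<longleftrightarrow>
     \<not> (\<exists>M1 M2. is_matroid M1 \<and> is_matroid M2 \<and> ground M1 \<noteq> {} \<and> ground M2 \<noteq> {} \<and>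
          ground M1 \<inter> ground M2 = {} \<and> M = direct_sum M1 M2)"

definition stressed :: "'a matroid \<Rightarrow> 'a set \<Rightarrow> bool" where
  "stressed M A \<longleftrightarrow> A \<subseteq> ground M \<and> uniform (restriction M A) \<and> uniform (contraction M A)"

definition cover :: "'a matroid \<Rightarrow> 'a set \<Rightarrow> 'a set set" where
  "cover M A = {S. S \<subseteq> ground M \<and> card S = rank M \<and> rk M A + 1 \<le> card (S \<inter> A)}"

definition flacet :: "'a matroid \<Rightarrow> 'a set \<Rightarrow> bool" where
  "flacet M F \<longleftrightarrow> flat M F \<and> connected (restriction M F) \<and> connected (contraction M F)"

definition split_flacet :: "'a matroid \<Rightarrow> 'a set \<Rightarrow> bool" where
  "split_flacet M F \<longleftrightarrow>
     flacet M F \<and> 0 < rk M F \<and> rk M F < card F \<and> (\<exists>e\<in>ground M - F. \<not> coloop M e)"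

definition connected_split :: "'a matroid \<Rightarrow> bool" where
  "connected_split M \<longleftrightarrow>
     is_matroid M \<and> connected M \<and> (\<forall>F. split_flacet M F \<longrightarrow> stressed M F)"

definition elementary_split :: "'a matroid \<Rightarrow> bool" where
  "elementary_split M \<longleftrightarrow>
     connected_split M \<or>
     (\<exists>M1 M2. uniform M1 \<and> uniform M2 \<and> ground M1 \<inter> ground M2 = {} \<and> M = direct_sum M1 M2)"

text \<open>Bivariate integer polynomials are elements of \<open>\<int>[x][y]\<close>: \<open>var_x\<close> is the variable of the
  coefficient ring, \<open>var_y\<close> the outer variable.\<close>

definition var_x :: "int poly poly" where "var_x = [:[:0, 1:]:]"

definition var_y :: "int poly poly" where "var_y = [:0, 1:]"

definition tutte :: "'a matroid \<Rightarrow> int poly poly" where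
  "tutte M = (\<Sum>A\<in>Pow (ground M).
     (var_x - 1) ^ (rk M (ground M) - rk M A) * (var_y - 1) ^ (card A - rk M A))"

definition stressed_count :: "'a matroid \<Rightarrow> nat \<Rightarrow> nat \<Rightarrow> nat" where
  "stressed_count M r h = card {A. stressed M A \<and> cover M A \<noteq> {} \<and> rk M A = r \<and> card A = h}"

text \<open>For \<open>r < i\<close> and \<open>j < k - r\<close> none of the subtractions in the branch taken truncates.\<close>

definition alpha :: "nat \<Rightarrow> nat \<Rightarrow> nat \<Rightarrow> nat \<Rightarrow> int poly poly" where
  "alpha r k i j =
     (if i + j \<le> k
      then (var_x - 1) ^ (k - i - j) * (1 - ((var_x - 1) * (var_y - 1)) ^ (i - r))
      else (var_y - 1) ^ (i + j - k) * (1 - ((var_x - 1) * (var_y - 1)) ^ (k - r - j)))"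

end

theory Submission
  imports Defs
begin

text \<open>Compare the two Tutte polynomials subset by subset: \<open>S\<close> contributes differently to \<open>M\<close> and
  to the uniform matroid iff \<open>rk M S < min k (card S)\<close>. For a stressed \<open>A\<close>, the sets with
  \<open>rk A < card (S \<inter> A)\<close> and \<open>card (S - A) < k - rk A\<close> are of this kind, their rank is
  \<open>rk A + card (S - A)\<close>, and \<open>alpha\<close> is the resulting difference. No \<open>S\<close> arises from two
  stressed sets, because \<open>A\<close> is the closure of the set of elements of \<open>S\<close> that are not coloops of
  \<open>M|S\<close>.

  Conversely, a subset \<open>X\<close> of \<open>S\<close> that is minimal with the same nullity as \<open>S\<close> spans a cyclic flat
  \<open>F\<close> of rank less than \<open>k\<close> that serves as \<open>A\<close> once it is stressed. In a connected split matroid this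
  holds because \<open>F\<close> is a split flacet: if \<open>M|F\<close> is connected and \<open>G\<close> is a component of a
  disconnected \<open>M/F\<close>, then \<open>E - G\<close> is a split flacet whose restriction contains the dependent
  non-spanning set \<open>F\<close>; and if \<open>M|F\<close> is disconnected with a component \<open>T\<close>, then \<open>T\<close> is stressed by
  the previous case, but \<open>F - T\<close> is dependent and non-spanning in \<open>M/T\<close>.\<close>

section \<open>Rank functions\<close>

locale matroid =
  fixes M :: "'a matroid"
  assumes is_matroid: "is_matroid M"
begin

abbreviation E where "E \<equiv> ground M"
abbreviation r where "r \<equiv> rk M"

lemma finite_ground [simp]: "finite E"
  using is_matroid by (simp add: is_matroid_def)

lemma indep_subset_ground: "I \<in> indeps M \<Longrightarrow> I \<subseteq> E"
  using is_matroid by (simp add: is_matroid_def)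

lemma indep_finite: "I \<in> indeps M \<Longrightarrow> finite I"
  using finite_subset[OF indep_subset_ground] by simp

lemma indep_empty [simp]: "{} \<in> indeps M"
  using is_matroid by (simp add: is_matroid_def)

lemma indep_mono: "I \<in> indeps M \<Longrightarrow> J \<subseteq> I \<Longrightarrow> J \<in> indeps M"
  using is_matroid unfolding is_matroid_def by blast

lemma indep_augment:
  "I \<in> indeps M \<Longrightarrow> J \<in> indeps M \<Longrightarrow> card I < card J \<Longrightarrow> \<exists>e\<in>J - I. insert e I \<in> indeps M"
  using is_matroid unfolding is_matroid_def by blast

lemma finite_indeps [simp]: "finite (indeps M)"
  by (rule finite_subset[of _ "Pow E"]) (auto dest: indep_subset_ground)

lemma card_le_rk: "I \<in> indeps M \<Longrightarrow> I \<subseteq> A \<Longrightarrow> card I \<le> r A"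
  unfolding rk_def by (rule Max_ge) auto

lemma rk_witness:
  obtains I where "I \<in> indeps M" "I \<subseteq> A" "card I = r A"
proof -
  have "r A \<in> card ` {I \<in> indeps M. I \<subseteq> A}"
    unfolding rk_def by (rule Max_in) (auto intro!: exI[of _ "{}"])
  then show ?thesis using that by auto
qed

lemma rk_mono: "A \<subseteq> B \<Longrightarrow> r A \<le> r B"
  by (metis rk_witness card_le_rk subset_trans)

lemma rk_le_card: "finite A \<Longrightarrow> r A \<le> card A"
  by (metis rk_witness card_mono)

lemma rk_empty [simp]: "r {} = 0"
  using rk_le_card[of "{}"] by simp

lemma indep_iff_rk: "I \<subseteq> E \<Longrightarrow> I \<in> indeps M \<longleftrightarrow> r I = card I"
proof
  assume "I \<subseteq> E" "r I = card I"
  then show "I \<in> indeps M"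
    by (metis rk_witness card_subset_eq finite_subset finite_ground)
qed (metis card_le_rk indep_finite order_antisym order_refl rk_le_card)

lemma indep_extend:
  assumes "I \<in> indeps M" "I \<subseteq> A"
  obtains J where "J \<in> indeps M" "I \<subseteq> J" "J \<subseteq> A" "card J = r A"
proof -
  have "\<exists>J\<in>indeps M. I \<subseteq> J \<and> J \<subseteq> A \<and> card J = r A"
    using assms
  proof (induction "r A - card I" arbitrary: I)
    case 0
    then show ?case using card_le_rk[of I A] by (intro bexI[of _ I]) auto
  next
    case (Suc m)
    obtain B where B: "B \<in> indeps M" "B \<subseteq> A" "card B = r A" by (rule rk_witness)
    have "card I < card B" using Suc.hyps(2) B by linarith
    then obtain e where e: "e \<in> B - I" "insert e I \<in> indeps M"
      using indep_augment Suc.prems(1) B(1) by blast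
    have "card (insert e I) = Suc (card I)"
      using e Suc.prems indep_finite by auto
    then obtain J where "J \<in> indeps M" "insert e I \<subseteq> J" "J \<subseteq> A" "card J = r A"
      using Suc.hyps(1)[of "insert e I"] Suc.hyps(2) Suc.prems(2) e B(2)
      by (metis Diff_iff add_diff_cancel_left' diff_diff_left insert_subset plus_1_eq_Suc subsetD add.commute)
    then show ?case by auto
  qed
  then show ?thesis using that by blast
qed

text \<open>Extend a basis \<open>I\<close> of \<open>A \<inter> B\<close> to a basis
  \<open>J\<close> of \<open>A \<union> B\<close>: the traces of \<open>J\<close> on
  \<open>A\<close> and on \<open>B\<close> are independent, and their overlap contains
  \<open>I\<close>.\<close>

lemma rk_submodular: "r (A \<union> B) + r (A \<inter> B) \<le> r A + r B"
proof -
  obtain I where I: "I \<in> indeps M" "I \<subseteq> A \<inter> B" "card I = r (A \<inter> B)" by (rule rk_witness)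
  obtain J where J: "J \<in> indeps M" "I \<subseteq> J" "J \<subseteq> A \<union> B" "card J = r (A \<union> B)"
    using indep_extend[of I "A \<union> B"] I by auto
  have fin: "finite J" using J indep_finite by auto
  have "card (J \<inter> A) \<le> r A" "card (J \<inter> B) \<le> r B"
    using J indep_mono by (auto intro!: card_le_rk)
  moreover have "card (J \<inter> A) + card (J \<inter> B) = card J + card (J \<inter> A \<inter> B)"
  proof -
    have "J \<inter> A \<union> J \<inter> B = J" "J \<inter> A \<inter> (J \<inter> B) = J \<inter> A \<inter> B" using J(3) by auto
    then show ?thesis using card_Un_Int[of "J \<inter> A" "J \<inter> B"] fin by simp
  qed
  moreover have "card I \<le> card (J \<inter> A \<inter> B)"
    using I J fin by (intro card_mono) auto
  ultimately show ?thesis using I J by linarith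
qed

text \<open>The form applied below: any subset of the union and any common subset will do, so no set
  identities are needed at the point of use.\<close>

lemma rk_submodular':
  assumes "C \<subseteq> A \<union> B" "D \<subseteq> A" "D \<subseteq> B"
  shows "r C + r D \<le> r A + r B"
  using rk_submodular[of A B] rk_mono[of C "A \<union> B"] rk_mono[of D "A \<inter> B"] assms by fastforce

lemma rk_Un_le: "C \<subseteq> A \<union> B \<Longrightarrow> r C \<le> r A + r B"
  using rk_submodular'[of C A B "{}"] by simp

lemma rk_le_add_card: "finite B \<Longrightarrow> C \<subseteq> A \<union> B \<Longrightarrow> r C \<le> r A + card B"
  using rk_Un_le[of C A B] rk_le_card[of B] by linarith

lemma rk_insert_le: "r (insert e A) \<le> Suc (r A)"
  using rk_le_add_card[of "{e}" "insert e A" A] by simp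

lemma rk_Un_eq:
  assumes "finite B" "\<And>e. e \<in> B \<Longrightarrow> r (insert e A) = r A"
  shows "r (A \<union> B) = r A"
  using assms
proof (induction B)
  case (insert e B)
  have "r (A \<union> insert e B) + r A \<le> r (A \<union> B) + r (insert e A)"
    by (rule rk_submodular') auto
  moreover have "r A \<le> r (A \<union> insert e B)" by (rule rk_mono) auto
  ultimately show ?case using insert by simp
qed simp

text \<open>A basis of \<open>X\<close> in the contraction by \<open>A\<close>, built greedily: by
  submodularity, an element that raises the rank over \<open>X \<union> A\<close> also raises it
  over the smaller \<open>I \<union> A\<close>.\<close>

lemma rk_contract_witness:
  assumes "finite X"
  obtains I where "I \<subseteq> X" "r (I \<union> A) = r A + card I" "r (I \<union> A) = r (X \<union> A)"
proof -
  have "\<exists>I\<subseteq>X. r (I \<union> A) = r A + card I \<and> r (I \<union> A) = r (X \<union> A)"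
    using assms
  proof (induction X)
    case (insert e X)
    then obtain I where I: "I \<subseteq> X" "r (I \<union> A) = r A + card I" "r (I \<union> A) = r (X \<union> A)" by auto
    show ?case
    proof (cases "r (insert e X \<union> A) = r (X \<union> A)")
      case True
      then show ?thesis using I by (intro exI[of _ I]) auto
    next
      case False
      have "r (insert e X \<union> A) + r (I \<union> A) \<le> r (insert e I \<union> A) + r (X \<union> A)"
        by (rule rk_submodular') (use I in auto)
      moreover have "card (insert e I) = Suc (card I)"
        using I insert.hyps by (meson card_insert_disjoint finite_subset in_mono)
      moreover have "r (X \<union> A) \<le> r (insert e X \<union> A)" "r (insert e I \<union> A) \<le> r (insert e X \<union> A)"
        by (rule rk_mono, use I in blast)+
      moreover have "r (insert e X \<union> A) \<le> Suc (r (X \<union> A))"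
        using rk_insert_le[of e "X \<union> A"] by simp
      ultimately show ?thesis
        using I False by (intro exI[of _ "insert e I"]) auto
    qed
  qed auto
  then show ?thesis using that by blast
qed

lemma rk_restriction: "X \<subseteq> A \<Longrightarrow> rk (restriction M A) X = r X"
  unfolding rk_def restriction_def
  by (rule arg_cong[where f = "\<lambda>S. Max (card ` S)"]) auto

text \<open>Obtained directly from the maximum defining \<open>rk\<close>, without first showing
  that the contraction is a matroid.\<close>

lemma rk_contraction:
  assumes "X \<subseteq> E - A"
  shows "rk (contraction M A) X = r (X \<union> A) - r A"
proof -
  have fin: "finite X" using assms finite_ground by (meson finite_Diff finite_subset)
  let ?S = "card ` {I \<in> indeps (contraction M A). I \<subseteq> X}"
  have "finite ?S" using fin by simp
  moreover have "y \<le> r (X \<union> A) - r A" if "y \<in> ?S" for y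
  proof -
    obtain I where "y = card I" "I \<subseteq> X" "r (I \<union> A) = r A + card I"
      using \<open>y \<in> ?S\<close> by (auto simp: contraction_def)
    moreover from this have "r (I \<union> A) \<le> r (X \<union> A)" by (intro rk_mono) auto
    ultimately show ?thesis by simp
  qed
  moreover obtain I where "I \<subseteq> X" "r (I \<union> A) = r A + card I" "r (I \<union> A) = r (X \<union> A)"
    using fin by (rule rk_contract_witness)
  then have "r (X \<union> A) - r A \<in> ?S"
    using assms by (auto simp: contraction_def intro!: image_eqI[of _ _ I])
  ultimately show ?thesis unfolding rk_def by (rule Max_eqI)
qed

lemma matroid_restriction: "A \<subseteq> E \<Longrightarrow> is_matroid (restriction M A)"
  unfolding is_matroid_def[of "restriction M A"]
proof (intro conjI ballI impI allI)
  fix I J assume "I \<in> indeps (restriction M A)" "J \<in> indeps (restriction M A)" "card I < card J"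
  then show "\<exists>e\<in>J - I. insert e I \<in> indeps (restriction M A)"
    using indep_augment[of I J] by (auto simp: restriction_def)
qed (auto simp: restriction_def intro: indep_mono finite_subset[of A E])

end

section \<open>Direct sums and uniform matroids: rank formulas\<close>

lemma rk_direct_sum:
  assumes "is_matroid M" "is_matroid N" "ground M \<inter> ground N = {}"
  shows "rk (direct_sum M N) X = rk M (X \<inter> ground M) + rk N (X \<inter> ground N)"
proof -
  interpret M: matroid M by standard fact
  interpret N: matroid N by standard fact
  let ?T = "{K \<in> indeps (direct_sum M N). K \<subseteq> X}"
  have "finite ?T"
    by (rule finite_subset[of _ "Pow (ground M \<union> ground N)"])
      (auto simp: direct_sum_def dest: M.indep_subset_ground N.indep_subset_ground)
  then have "finite (card ` ?T)" by simp
  moreover have "y \<le> rk M (X \<inter> ground M) + rk N (X \<inter> ground N)" if y: "y \<in> card ` ?T" for y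
  proof -
    obtain I J where IJ: "I \<in> indeps M" "J \<in> indeps N" "I \<union> J \<subseteq> X" "y = card (I \<union> J)"
      using y by (auto simp: direct_sum_def)
    have "y \<le> card I + card J" using IJ card_Un_le by auto
    also have "card I \<le> rk M (X \<inter> ground M)"
      using IJ M.indep_subset_ground by (intro M.card_le_rk) auto
    also have "card J \<le> rk N (X \<inter> ground N)"
      using IJ N.indep_subset_ground by (intro N.card_le_rk) auto
    finally show ?thesis by simp
  qed
  moreover have "rk M (X \<inter> ground M) + rk N (X \<inter> ground N) \<in> card ` ?T"
  proof -
    obtain I where I: "I \<in> indeps M" "I \<subseteq> X \<inter> ground M" "card I = rk M (X \<inter> ground M)"
      by (rule M.rk_witness)
    obtain J where J: "J \<in> indeps N" "J \<subseteq> X \<inter> ground N" "card J = rk N (X \<inter> ground N)"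
      by (rule N.rk_witness)
    have "card (I \<union> J) = card I + card J"
      using I J assms(3) M.indep_finite N.indep_finite by (intro card_Un_disjoint) auto
    then show ?thesis
      using I J by (intro image_eqI[of _ _ "I \<union> J"]) (auto simp: direct_sum_def)
  qed
  ultimately show ?thesis unfolding rk_def[of "direct_sum M N"] by (rule Max_eqI)
qed

lemma rk_uniform_on:
  assumes "finite A" "X \<subseteq> A"
  shows "rk (uniform_on q A) X = min (card X) q"
proof -
  have fin: "finite X" using assms finite_subset by auto
  let ?S = "card ` {I \<in> indeps (uniform_on q A). I \<subseteq> X}"
  have "finite ?S" using fin by simp
  moreover have "y \<le> min (card X) q" if "y \<in> ?S" for y
    using that fin by (auto simp: uniform_on_def intro: card_mono)
  moreover obtain Y where "Y \<subseteq> X" "card Y = min (card X) q"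
    by (meson min.cobounded1 obtain_subset_with_card_n)
  then have "min (card X) q \<in> ?S"
    using assms by (auto simp: uniform_on_def intro!: image_eqI[of _ _ Y])
  ultimately show ?thesis unfolding rk_def by (rule Max_eqI)
qed

lemma is_matroid_uniform_on:
  assumes "finite A"
  shows "is_matroid (uniform_on q A)"
proof -
  have "\<exists>e\<in>J - I. insert e I \<in> indeps (uniform_on q A)"
    if "I \<in> indeps (uniform_on q A)" "J \<in> indeps (uniform_on q A)" "card I < card J" for I J
  proof -
    have IJ: "I \<subseteq> A" "J \<subseteq> A" "card J \<le> q" using that by (auto simp: uniform_on_def)
    then have "finite I" using assms finite_subset by blast
    moreover from this have "\<not> J \<subseteq> I" using that(3) card_mono[of I J] by auto
    then obtain e where "e \<in> J - I" by blast
    moreover from calculation have "card (insert e I) \<le> q" using that(3) IJ by simp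
    ultimately show ?thesis using IJ by (intro bexI[of _ e]) (auto simp: uniform_on_def)
  qed
  moreover have "J \<in> indeps (uniform_on q A)" if "I \<in> indeps (uniform_on q A)" "J \<subseteq> I" for I J
    using that assms card_mono[of I J] finite_subset[of I A] by (auto simp: uniform_on_def)
  moreover have "{} \<in> indeps (uniform_on q A)" "ground (uniform_on q A) = A"
    "\<forall>I\<in>indeps (uniform_on q A). I \<subseteq> A"
    by (auto simp: uniform_on_def)
  ultimately show ?thesis
    unfolding is_matroid_def using assms by simp
qed

lemma uniform_uniform_on: "finite A \<Longrightarrow> q \<le> card A \<Longrightarrow> uniform (uniform_on q A)"
  unfolding uniform_def using is_matroid_uniform_on[of A q] by (auto simp: uniform_on_def)

section \<open>Connectivity and stressed sets\<close>

text \<open>\<open>minor_connected M A B\<close> says that the minor \<open>(M|B)/A\<close> has no proper non-empty separator.\<close>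

definition minor_connected :: "'a matroid \<Rightarrow> 'a set \<Rightarrow> 'a set \<Rightarrow> bool" where
  "minor_connected M A B \<longleftrightarrow>
     (\<forall>T. T \<subseteq> B - A \<longrightarrow> T \<noteq> {} \<longrightarrow> T \<noteq> B - A \<longrightarrow> rk M B + rk M A < rk M (A \<union> T) + rk M (B - T))"

section \<open>Separators and stressed sets in terms of the rank function\<close>

context matroid
begin

text \<open>Rank is additive on direct sums, so the ground set of a summand would be a
  separator.\<close>

lemma minor_connected_imp_connected_restriction:
  assumes "minor_connected M {} F"
  shows "connected (restriction M F)"
  unfolding connected_def
proof (intro notI, elim exE conjE)
  fix M1 M2
  assume as: "is_matroid M1" "is_matroid M2" "ground M1 \<noteq> {}" "ground M2 \<noteq> {}"
    "ground M1 \<inter> ground M2 = {}" "restriction M F = direct_sum M1 M2"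
  have F: "F = ground M1 \<union> ground M2"
    using arg_cong[OF as(6), of ground] by (simp add: restriction_def direct_sum_def)
  interpret M1: matroid M1 by standard fact
  interpret M2: matroid M2 by standard fact
  have eq: "r X = rk M1 (X \<inter> ground M1) + rk M2 (X \<inter> ground M2)" if "X \<subseteq> F" for X
    using that rk_restriction[of X F] rk_direct_sum[OF as(1,2,5), of X] as(6) by simp
  have "F - ground M1 = ground M2" using F as(5) by auto
  moreover have "r F = rk M1 (ground M1) + rk M2 (ground M2)"
    "r (ground M1) = rk M1 (ground M1)" "r (ground M2) = rk M2 (ground M2)"
    using eq[of F] eq[of "ground M1"] eq[of "ground M2"] F as(5)
    by (auto simp: Int_absorb1 Int_commute)
  ultimately show False
    using assms[unfolded minor_connected_def, rule_format, of "ground M1"] F as by auto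
qed

lemma minor_connected_imp_connected_contraction:
  assumes "minor_connected M F E" "F \<subseteq> E"
  shows "connected (contraction M F)"
  unfolding connected_def
proof (intro notI, elim exE conjE)
  fix M1 M2
  assume as: "is_matroid M1" "is_matroid M2" "ground M1 \<noteq> {}" "ground M2 \<noteq> {}"
    "ground M1 \<inter> ground M2 = {}" "contraction M F = direct_sum M1 M2"
  have F: "E - F = ground M1 \<union> ground M2"
    using arg_cong[OF as(6), of ground] by (simp add: contraction_def direct_sum_def)
  interpret M1: matroid M1 by standard fact
  interpret M2: matroid M2 by standard fact
  have eq: "r (X \<union> F) - r F = rk M1 (X \<inter> ground M1) + rk M2 (X \<inter> ground M2)" if "X \<subseteq> E - F" for X
    using that rk_contraction[of X F] rk_direct_sum[OF as(1,2,5), of X] as(6) by simp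
  have "E - ground M1 = ground M2 \<union> F" "E - F \<union> F = E" "F \<union> ground M1 = ground M1 \<union> F"
    using F as(5) assms(2) by auto
  moreover have "r (E - F \<union> F) - r F = rk M1 (ground M1) + rk M2 (ground M2)"
    "r (ground M1 \<union> F) - r F = rk M1 (ground M1)" "r (ground M2 \<union> F) - r F = rk M2 (ground M2)"
    using eq[of "E - F"] eq[of "ground M1"] eq[of "ground M2"] F as(5)
    by (auto simp: Int_absorb1 Int_commute)
  \<comment> \<open>These inequalities make the truncated subtractions above exact.\<close>
  moreover have "r F \<le> r E" "r F \<le> r (ground M1 \<union> F)" "r F \<le> r (ground M2 \<union> F)"
    using assms by (auto intro!: rk_mono)
  ultimately have "r E + r F = r (F \<union> ground M1) + r (E - ground M1)"
    by (simp add: Un_commute)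
  moreover have "ground M1 \<subseteq> E - F" "ground M1 \<noteq> E - F" using F as by auto
  ultimately show False
    using assms(1)[unfolded minor_connected_def, rule_format, of "ground M1"] as(3) by simp
qed

text \<open>If \<open>T\<close> is a separator, independent subsets of \<open>T\<close> and of
  \<open>E - T\<close> have independent unions, so \<open>M\<close> is the direct sum of its
  restrictions to \<open>T\<close> and \<open>E - T\<close>.\<close>

lemma connected_imp_minor_connected:
  assumes "connected M"
  shows "minor_connected M {} E"
  unfolding minor_connected_def
proof (intro allI impI, rule ccontr)
  fix T assume T: "T \<subseteq> E - {}" "T \<noteq> {}" "T \<noteq> E - {}" and "\<not> r E + r {} < r ({} \<union> T) + r (E - T)"
  then have le: "r T + r (E - T) \<le> r E" by simp
  have "I \<union> J \<in> indeps M" if IJ: "I \<in> indeps M" "I \<subseteq> T" "J \<in> indeps M" "J \<subseteq> E - T" for I J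
  proof -
    \<comment> \<open>First \<open>J\<close> is seen to add its full rank to \<open>T\<close>, then
      to the subset \<open>I\<close> of \<open>T\<close>.\<close>
    have "r E + r J \<le> r (T \<union> J) + r (E - T)" by (rule rk_submodular') (use IJ T in auto)
    moreover have "r (T \<union> J) + r I \<le> r (I \<union> J) + r T" by (rule rk_submodular') (use IJ in auto)
    moreover have "r I = card I" "r J = card J"
      using IJ indep_iff_rk[of I] indep_iff_rk[of J] indep_subset_ground by auto
    moreover have "card (I \<union> J) \<le> card I + card J" by (rule card_Un_le)
    moreover have "r (I \<union> J) \<le> card (I \<union> J)"
      using IJ indep_finite by (intro rk_le_card) auto
    ultimately show ?thesis
      using le indep_iff_rk[of "I \<union> J"] IJ indep_subset_ground by auto
  qed
  moreover have "I \<in> {I \<union> J |I J. I \<in> indeps M \<and> I \<subseteq> T \<and> J \<in> indeps M \<and> J \<subseteq> E - T}"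
    if "I \<in> indeps M" for I
  proof -
    have "I = (I \<inter> T) \<union> (I - T)" by auto
    moreover have "I \<inter> T \<in> indeps M" "I - T \<in> indeps M" using that indep_mono by auto
    ultimately show ?thesis using that indep_subset_ground by blast
  qed
  ultimately have "M = direct_sum (restriction M T) (restriction M (E - T))"
    using T by (cases M) (auto simp: direct_sum_def restriction_def)
  moreover have "ground (restriction M T) = T" "ground (restriction M (E - T)) = E - T"
    by (auto simp: restriction_def)
  ultimately show False
    using assms matroid_restriction[of T] matroid_restriction[of "E - T"] T
    unfolding connected_def by (metis Diff_disjoint Diff_empty Diff_eq_empty_iff Diff_subset subset_antisym)
qed

text \<open>Uniformity of the two minors becomes a pair of rank formulas. The ranks of the uniform
  matroids are forced: evaluate at \<open>A\<close> and at \<open>E - A\<close>.\<close>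

lemma stressed_iff:
  "stressed M A \<longleftrightarrow> A \<subseteq> E \<and> (\<forall>X\<subseteq>A. r X = min (card X) (r A)) \<and>
     (\<forall>X\<subseteq>E - A. r (X \<union> A) = r A + min (card X) (rank M - r A))" (is "_ \<longleftrightarrow> ?R")
proof
  assume st: "stressed M A"
  then have A: "A \<subseteq> E" and u: "uniform (restriction M A)" "uniform (contraction M A)"
    by (auto simp: stressed_def)
  have finA: "finite A" using A finite_ground by (rule finite_subset)
  obtain q where q: "q \<le> card A" "restriction M A = uniform_on q A"
    using u(1) by (auto simp: uniform_def restriction_def)
  obtain p where p: "p \<le> card (E - A)" "contraction M A = uniform_on p (E - A)"
    using u(2) by (auto simp: uniform_def contraction_def)
  have rX: "r X = min (card X) q" if "X \<subseteq> A" for X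
    using rk_restriction[OF that] rk_uniform_on[OF finA that] q by simp
  have cX: "r (X \<union> A) - r A = min (card X) p" if "X \<subseteq> E - A" for X
    using rk_contraction[OF that] rk_uniform_on[OF _ that, of p] p by simp
  have "r A = q" using rX[of A] q by simp
  moreover have "E - A \<union> A = E" using A by auto
  then have "p = rank M - r A" using cX[of "E - A"] p by (simp add: rank_def)
  moreover have "r A \<le> r (X \<union> A)" for X by (rule rk_mono) auto
  ultimately show ?R using A rX cX by (metis le_add_diff_inverse)
next
  assume R: ?R
  then have A: "A \<subseteq> E" by simp
  have finA: "finite A" using A finite_ground by (rule finite_subset)
  have "I \<in> indeps M \<longleftrightarrow> card I \<le> r A" if "I \<subseteq> A" for I
  proof -
    have "r I = min (card I) (r A)" "I \<subseteq> E" using R that by blast+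
    then show ?thesis using indep_iff_rk[of I] by (simp add: min_def)
  qed
  then have "restriction M A = uniform_on (r A) A"
    unfolding restriction_def uniform_on_def by (metis (mono_tags, lifting) Collect_cong)
  moreover have "r (I \<union> A) = r A + card I \<longleftrightarrow> card I \<le> rank M - r A" if "I \<subseteq> E - A" for I
  proof -
    have "r (I \<union> A) = r A + min (card I) (rank M - r A)" using R that by blast
    then show ?thesis by (simp add: min_def)
  qed
  then have "contraction M A = uniform_on (rank M - r A) (E - A)"
    unfolding contraction_def uniform_on_def by (metis (mono_tags, lifting) Collect_cong)
  moreover have "r A \<le> card A" by (simp add: finA rk_le_card)
  moreover have "rank M - r A \<le> card (E - A)"
    using rk_le_add_card[of "E - A" E A] by (auto simp: rank_def)
  ultimately show "stressed M A"
    using A finA by (auto simp: stressed_def uniform_uniform_on)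
qed

text \<open>Any \<open>r A\<close> elements of \<open>A\<close> span \<open>A\<close>, so
  \<open>X\<close> has the rank of \<open>X \<union> A\<close>, which the uniform contraction
  determines.\<close>

lemma rk_stressed:
  assumes "stressed M A" "X \<subseteq> E" "r A \<le> card (X \<inter> A)"
  shows "r X = r A + min (card (X - A)) (rank M - r A)"
proof -
  have "r (X \<inter> A) = r A" using assms unfolding stressed_iff by (metis Int_lower2 min_absorb2)
  moreover have "r (X \<union> A) + r (X \<inter> A) \<le> r X + r A" by (rule rk_submodular)
  moreover have "r X \<le> r (X \<union> A)" by (rule rk_mono) auto
  moreover have "r (X \<union> A) = r A + min (card (X - A)) (rank M - r A)"
  proof -
    have "X \<union> A = (X - A) \<union> A" "X - A \<subseteq> E - A" using assms by auto
    then show ?thesis using assms(1) unfolding stressed_iff by metis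
  qed
  ultimately show ?thesis by linarith
qed

lemma minor_connectedD:
  "minor_connected M A B \<Longrightarrow> T \<subseteq> B - A \<Longrightarrow> T \<noteq> {} \<Longrightarrow> T \<noteq> B - A \<Longrightarrow>
     r B + r A < r (A \<union> T) + r (B - T)"
  by (simp add: minor_connected_def)

text \<open>A separator of least size is a connected component of the minor. Its minimality later
  yields connectivity of smaller minors.\<close>

lemma not_minor_connected_minimal:
  assumes "\<not> minor_connected M A B" "B \<subseteq> E"
  obtains T where "T \<subseteq> B - A" "T \<noteq> {}" "T \<noteq> B - A" "r (A \<union> T) + r (B - T) \<le> r B + r A"
    "\<And>S. S \<subset> T \<Longrightarrow> S \<noteq> {} \<Longrightarrow> r B + r A < r (A \<union> S) + r (B - S)"
proof -
  define P where
    "P T \<longleftrightarrow> T \<subseteq> B - A \<and> T \<noteq> {} \<and> T \<noteq> B - A \<and> r (A \<union> T) + r (B - T) \<le> r B + r A" for T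
  have "\<exists>T. P T" using assms(1) unfolding minor_connected_def P_def by (meson not_less)
  then obtain T where T: "P T" "\<And>S. P S \<Longrightarrow> card T \<le> card S"
    using ex_has_least_nat[of P _ card] by blast
  have "finite T" using T(1) assms(2) finite_ground unfolding P_def by (meson finite_Diff finite_subset)
  have "r B + r A < r (A \<union> S) + r (B - S)" if "S \<subset> T" "S \<noteq> {}" for S
  proof (rule ccontr)
    assume "\<not> ?thesis"
    moreover have "S \<subseteq> B - A" "S \<noteq> B - A" using that(1) T(1) unfolding P_def by blast+
    ultimately have "P S" using that(2) by (simp add: P_def)
    then show False using T(2)[of S] psubset_card_mono[OF \<open>finite T\<close> that(1)] by simp
  qed
  then show ?thesis using T(1) that by (auto simp: P_def)
qed

context
  assumes connected: "minor_connected M {} E"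
begin

text \<open>A loop would be a separator.\<close>

lemma connected_rk_singleton:
  assumes "e \<in> E" "E \<noteq> {e}"
  shows "0 < r {e}"
proof -
  have "r E < r {e} + r (E - {e})"
    using minor_connectedD[OF connected, of "{e}"] assms by auto
  moreover have "r (E - {e}) \<le> r E" by (rule rk_mono) auto
  ultimately show ?thesis by linarith
qed

text \<open>By connectivity \<open>E - {e}\<close> has full rank, so it contains a basis of
  \<open>M\<close>, and this basis avoids \<open>e\<close>.\<close>

lemma connected_not_coloop:
  assumes "e \<in> E" "E \<noteq> {e}"
  shows "\<not> coloop M e"
proof
  assume c: "coloop M e"
  have "r E < r {e} + r (E - {e})"
    using minor_connectedD[OF connected, of "{e}"] assms by auto
  moreover have "r {e} \<le> 1" using rk_le_card[of "{e}"] by simp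
  ultimately have le: "r E \<le> r (E - {e})" by linarith
  obtain B where B: "B \<in> indeps M" "B \<subseteq> E - {e}" "card B = r (E - {e})" by (rule rk_witness)
  have "I = B" if "I \<in> indeps M" "B \<subseteq> I" for I
    using card_le_rk[OF that(1) indep_subset_ground[OF that(1)]] le B(3)
      card_seteq[OF indep_finite[OF that(1)] that(2)] by simp
  then have "basis M B" using B(1) by (auto simp: basis_def)
  then show False using c B(2) by (auto simp: coloop_def)
qed

end

end

section \<open>Cyclic flats of connected split matroids\<close>

locale split_matroid = matroid +
  assumes connected: "minor_connected M {} E"
    and split: "split_flacet M F \<Longrightarrow> stressed M F"
begin

text \<open>As \<open>F\<close> is non-empty and proper and \<open>M\<close> is connected, any
  element outside \<open>F\<close> is the non-coloop demanded by
  \<open>split_flacet\<close>.\<close>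

lemma flacet_stressed:
  assumes "flat M F" "minor_connected M {} F" "minor_connected M F E"
    and "0 < r F" "r F < card F" "F \<noteq> E"
  shows "stressed M F"
proof (rule split)
  have sub: "F \<subseteq> E" using assms(1) by (simp add: flat_def)
  obtain e where e: "e \<in> E - F" using sub assms(6) by auto
  have "F \<noteq> {}" using assms(4) by auto
  then have "\<not> coloop M e"
    using e sub by (intro connected_not_coloop[OF connected]) auto
  then show "split_flacet M F"
    using assms e sub minor_connected_imp_connected_restriction
      minor_connected_imp_connected_contraction
    by (auto simp: split_flacet_def flacet_def)
qed

lemma flat_insert: "flat M F \<Longrightarrow> e \<in> E \<Longrightarrow> e \<notin> F \<Longrightarrow> r F < r (insert e F)"
  by (simp add: flat_def)

text \<open>Let \<open>G\<close> be a component of a disconnected \<open>M/F\<close>, and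
  \<open>H = E - G\<close>. Connectivity of \<open>M/H\<close> comes from minimality of
  \<open>G\<close>, that of \<open>M|H\<close> from \<open>M\<close> and \<open>M|F\<close>, and
  flatness of \<open>H\<close> from that of \<open>F\<close>. So \<open>H\<close> is stressed, which
  the dependent set \<open>F\<close> of smaller rank contradicts.\<close>

lemma contraction_minor_connected:
  assumes F: "flat M F" "minor_connected M {} F" and pos: "0 < r F" and dep: "r F < card F"
    and nspan: "r F < rank M"
  shows "minor_connected M F E"
proof (rule ccontr)
  assume nc: "\<not> minor_connected M F E"
  have FE: "F \<subseteq> E" using F by (simp add: flat_def)
  obtain G where G: "G \<subseteq> E - F" "G \<noteq> {}" "G \<noteq> E - F" "r (F \<union> G) + r (E - G) \<le> r E + r F"
    and Gmin: "\<And>S. S \<subset> G \<Longrightarrow> S \<noteq> {} \<Longrightarrow> r E + r F < r (F \<union> S) + r (E - S)"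
    by (rule not_minor_connected_minimal[OF nc]) auto
  define H where "H = E - G"
  have FH: "F \<subset> H" "H \<subset> E" "E - H = G" using G FE by (auto simp: H_def)
  \<comment> \<open>\<open>M/F\<close> splits into its parts on \<open>G\<close> and
    \<open>H - F\<close>. Most inequalities below combine this with submodularity.\<close>
  have sep: "r (F \<union> G) + r H \<le> r E + r F" using G by (simp add: H_def)
  have "minor_connected M H E"
    unfolding minor_connected_def
  proof (intro allI impI)
    fix T assume T: "T \<subseteq> E - H" "T \<noteq> {}" "T \<noteq> E - H"
    have "r E + r F < r (F \<union> T) + r (E - T)" using Gmin[of T] T FH by auto
    moreover have "r E + r (F \<union> T) \<le> r (H \<union> T) + r (F \<union> G)"
      by (rule rk_submodular') (use T FH in auto)
    ultimately show "r E + r H < r (H \<union> T) + r (E - T)" using sep by linarith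
  qed
  moreover have "minor_connected M {} H"
  proof -
    \<comment> \<open>A separator of \<open>M|H\<close> that misses \<open>F\<close> would also
      separate \<open>M\<close>.\<close>
    have disj: "r H < r T + r (H - T)" if T: "T \<subseteq> H" "T \<noteq> {}" "T \<inter> F = {}" for T
    proof -
      have "T \<noteq> E" using T FH pos by auto
      then have "r E < r T + r (E - T)"
        using minor_connectedD[OF connected, of T] T FH by auto
      moreover have "r (E - T) + r F \<le> r (H - T) + r (F \<union> G)"
        by (rule rk_submodular') (use T FH in auto)
      ultimately show ?thesis using sep by linarith
    qed
    show ?thesis
      unfolding minor_connected_def
    proof (intro allI impI)
      fix T assume T: "T \<subseteq> H - {}" "T \<noteq> {}" "T \<noteq> H - {}"
      show "r H + r {} < r ({} \<union> T) + r (H - T)"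
      \<comment> \<open>Either \<open>T\<close> or its complement in \<open>H\<close> misses
        \<open>F\<close>, or \<open>T\<close> cuts \<open>F\<close> properly and connectivity of
        \<open>M|F\<close> applies.\<close>
      proof (cases "T \<inter> F = {} \<or> F \<subseteq> T")
        case True
        have "H - (H - T) = T" "H - T \<noteq> {}" using T by auto
        moreover have "(H - T) \<inter> F = {}" if "F \<subseteq> T" using that by auto
        ultimately show ?thesis using True disj[of T] disj[of "H - T"] T by auto
      next
        case False
        have "r F < r (F \<inter> T) + r (F - F \<inter> T)"
          using minor_connectedD[OF F(2), of "F \<inter> T"] False by auto
        moreover have "F - F \<inter> T = F - T" by auto
        moreover have "r (F \<union> T) + r (F \<inter> T) \<le> r F + r T" by (rule rk_submodular)
        moreover have "r H + r (F - T) \<le> r (F \<union> T) + r (H - T)"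
          by (rule rk_submodular') (use FH in auto)
        ultimately show ?thesis by simp
      qed
    qed
  qed
  moreover have "flat M H"
    unfolding flat_def
  proof (intro conjI ballI)
    fix e assume e: "e \<in> E - H"
    \<comment> \<open>As \<open>e\<close> lies in \<open>G\<close>, the rank jump from
      \<open>F\<close> to \<open>insert e F\<close> carries over to \<open>H\<close>.\<close>
    have "r E + r (insert e F) \<le> r (insert e H) + r (F \<union> G)"
      by (rule rk_submodular') (use e FH in auto)
    moreover have "r F < r (insert e F)" using e FH F(1) by (intro flat_insert) auto
    ultimately show "r H < r (insert e H)" using sep by linarith
  qed (use FH in auto)
  moreover have "0 < r H" using pos rk_mono[of F H] FH by auto
  moreover have "r H < card H"
  proof -
    have fin: "finite H" using FH finite_ground by (meson finite_subset psubset_imp_subset)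
    have "r H \<le> r F + card (H - F)" by (rule rk_le_add_card) (use fin in auto)
    moreover have "card H = card F + card (H - F)"
      using FH fin by (metis card_Diff_subset card_mono finite_subset le_add_diff_inverse psubset_imp_subset)
    ultimately show ?thesis using dep by linarith
  qed
  ultimately have "stressed M H" using FH by (intro flacet_stressed) auto
  moreover have "F \<subseteq> H" using FH by auto
  \<comment> \<open>\<open>F\<close> has more than \<open>r F\<close> elements, so uniformity of
    \<open>M|H\<close> forces \<open>r F = r H\<close>, while the flat \<open>F\<close> is a proper
    subset of \<open>H\<close>.\<close>
  ultimately have "r F = min (card F) (r H)" unfolding stressed_iff by blast
  then have "r H = r F" using dep by auto
  moreover obtain e where e: "e \<in> H - F" using FH by auto
  moreover have "r F < r (insert e F)" using e FH F(1) by (intro flat_insert) auto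
  moreover have "r (insert e F) \<le> r H" using e FH by (intro rk_mono) auto
  ultimately show False by simp
qed

lemma connected_flat_stressed:
  assumes "flat M F" "minor_connected M {} F" "0 < r F" "r F < card F" "r F < rank M"
  shows "stressed M F"
  using assms contraction_minor_connected by (intro flacet_stressed) (auto simp: rank_def)

text \<open>What remains is connectivity of \<open>M|F\<close>. Otherwise a smallest separator
  \<open>T\<close> is a connected flat, hence stressed, but \<open>F - T\<close> is dependent and
  non-spanning in the uniform matroid \<open>M/T\<close>.\<close>

lemma cyclic_flat_stressed:
  assumes F: "flat M F" "F \<noteq> {}" and cyc: "\<And>e. e \<in> F \<Longrightarrow> r (F - {e}) = r F"
    and nspan: "r F < rank M"
  shows "stressed M F"
proof -
  have FE: "F \<subset> E" using F nspan by (auto simp: flat_def rank_def)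
  have finF: "finite F" using FE finite_ground by (meson finite_subset psubset_imp_subset)
  have loopless: "0 < r X" if X: "X \<subseteq> E" "X \<noteq> {}" for X
  proof -
    obtain e where e: "e \<in> X" using X by auto
    \<comment> \<open>\<open>F\<close> is non-empty and proper, so \<open>E\<close> has at least two
      elements.\<close>
    have "E \<noteq> {e}" using FE F(2) by auto
    then have "0 < r {e}" using e X by (intro connected_rk_singleton[OF connected]) auto
    also have "r {e} \<le> r X" using e by (intro rk_mono) auto
    finally show ?thesis .
  qed
  \<comment> \<open>No element of \<open>F\<close> is a coloop of \<open>M|F\<close>, hence none of
    \<open>T\<close> is a coloop of \<open>M|T\<close>. The case \<open>T = F\<close> is included
    and used at the end.\<close>
  have dependent: "r T < card T"
    if T: "T \<subseteq> F" "T \<noteq> {}" and sep: "r T + r (F - T) \<le> r F" for T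
  proof -
    obtain e where e: "e \<in> T" using T by auto
    have "r F = r (F - {e})" using cyc e T by auto
    also have "\<dots> \<le> r (T - {e}) + r (F - T)" by (rule rk_Un_le) (use e in auto)
    finally have "r T \<le> r (T - {e})" using sep by linarith
    also have "\<dots> \<le> card (T - {e})" using T finF by (intro rk_le_card) (meson finite_Diff finite_subset)
    also have "\<dots> < card T" using e T finF by (meson card_Diff1_less finite_subset)
    finally show ?thesis .
  qed
  have "minor_connected M {} F"
  proof (rule ccontr)
    assume nc: "\<not> minor_connected M {} F"
    have "F \<subseteq> E" using FE by auto
    from nc this obtain T where T: "T \<subseteq> F - {}" "T \<noteq> {}" "T \<noteq> F - {}"
        "r ({} \<union> T) + r (F - T) \<le> r F + r {}"
      and Tmin: "\<And>S. S \<subset> T \<Longrightarrow> S \<noteq> {} \<Longrightarrow> r F + r {} < r ({} \<union> S) + r (F - S)"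
      by (rule not_minor_connected_minimal) auto
    have TF: "T \<subset> F" and sep: "r T + r (F - T) \<le> r F" using T by auto
    have "flat M T"
      unfolding flat_def
    proof (intro conjI ballI)
      fix e assume e: "e \<in> E - T"
      show "r T < r (insert e T)"
      proof (cases "e \<in> F")
        case True
        \<comment> \<open>The non-loop \<open>e\<close> lies in the complementary summand
          \<open>F - T\<close>, so it adds its full rank to \<open>T\<close>.\<close>
        have "r F + r {e} \<le> r (insert e T) + r (F - T)"
          by (rule rk_submodular') (use e True in auto)
        then show ?thesis using loopless[of "{e}"] e sep by auto
      next
        case False
        have "r (insert e F) + r T \<le> r (insert e T) + r F"
          by (rule rk_submodular') (use TF in auto)
        then show ?thesis using flat_insert[OF F(1), of e] e False by auto
      qed
    qed (use TF FE in auto)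
    moreover have "minor_connected M {} T"
      unfolding minor_connected_def
    proof (intro allI impI)
      fix S assume S: "S \<subseteq> T - {}" "S \<noteq> {}" "S \<noteq> T - {}"
      then have "r F < r S + r (F - S)" using Tmin[of S] by auto
      \<comment> \<open>A separator of \<open>M|T\<close> would be a smaller separator of
        \<open>M|F\<close>.\<close>
      moreover have "r (F - S) \<le> r (T - S) + r (F - T)" by (rule rk_Un_le) auto
      ultimately show "r T + r {} < r ({} \<union> S) + r (T - S)" using sep by simp
    qed
    moreover have "r T \<le> r F" using TF by (intro rk_mono) auto
    moreover have "0 < r T" using TF FE T by (intro loopless) auto
    moreover have "r T < card T" using TF T sep by (intro dependent) auto
    ultimately have "stressed M T" using nspan by (intro connected_flat_stressed) auto
    moreover have "F - T \<subseteq> E - T" "F - T \<union> T = F" using TF FE by auto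
    ultimately have "r F = r T + min (card (F - T)) (rank M - r T)"
      unfolding stressed_iff by metis
    \<comment> \<open>The complement of a separator is a separator, so \<open>dependent\<close>
      applies to \<open>F - T\<close> too.\<close>
    moreover have "F - (F - T) = T" using TF by auto
    then have "r (F - T) < card (F - T)" using TF sep by (intro dependent) auto
    moreover have "r F \<le> r T + r (F - T)" by (rule rk_Un_le) auto
    \<comment> \<open>The minimum can be neither term: \<open>card (F - T)\<close> exceeds the rank
      that \<open>F - T\<close> can add, and \<open>rank M - r T\<close> would make \<open>F\<close>
      spanning.\<close>
    ultimately show False using nspan sep by linarith
  qed
  moreover have "r F < card F" using F(2) by (intro dependent) auto
  moreover have "0 < r F" using F(2) FE by (intro loopless) auto
  ultimately show ?thesis using F(1) nspan by (intro connected_flat_stressed) auto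
qed

end

section \<open>Extraction of a cyclic flat from a rank-deficient set\<close>

context matroid
begin

lemma flat_closure:
  assumes "X \<subseteq> E"
  defines "F \<equiv> {e \<in> E. r (insert e X) = r X}"
  shows "X \<subseteq> F" "r F = r X" "flat M F"
proof -
  show XF: "X \<subseteq> F" using assms by (auto simp: insert_absorb)
  have "r (X \<union> F) = r X" by (rule rk_Un_eq) (auto simp: F_def)
  then show rF: "r F = r X" using XF by (simp add: Un_absorb1)
  show "flat M F"
    unfolding flat_def
  proof (intro conjI ballI)
    fix e assume e: "e \<in> E - F"
    then have "r (insert e X) \<noteq> r X" by (simp add: F_def)
    moreover have "r X \<le> r (insert e X)" by (rule rk_mono) auto
    moreover have "r (insert e X) \<le> r (insert e F)" using XF by (intro rk_mono) auto
    ultimately show "r F < r (insert e F)" using rF by linarith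
  qed (auto simp: F_def)
qed

text \<open>\<open>F\<close> is the closure of a smallest \<open>X\<close> in \<open>S\<close> with
  the nullity of \<open>S\<close>. Equal nullity means \<open>card (S - X) = r S - r X\<close>,
  which gives the last bound.\<close>

lemma cyclic_flat_of_deficient:
  assumes S: "S \<subseteq> E" "r S < rank M" "r S < card S"
  obtains F where "flat M F" "F \<noteq> {}" "\<And>e. e \<in> F \<Longrightarrow> r (F - {e}) = r F"
    "r F < card (S \<inter> F)" "card (S - F) < rank M - r F"
proof -
  \<comment> \<open>Equality of the nullities of \<open>X\<close> and \<open>S\<close>, written
    additively to avoid subtraction.\<close>
  define P where "P X \<longleftrightarrow> X \<subseteq> S \<and> card X + r S = r X + card S" for X
  obtain X where X: "P X" "\<And>Y. P Y \<Longrightarrow> card X \<le> card Y"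
    using ex_has_least_nat[of P S card] by (auto simp: P_def)
  have finS: "finite S" using S(1) finite_ground by (rule finite_subset)
  have XS: "X \<subseteq> S" "card X + r S = r X + card S" using X by (auto simp: P_def)
  have finX: "finite X" using XS finS finite_subset by blast
  have rX: "r X < card X" using XS S by linarith
  \<comment> \<open>Deleting a coloop of \<open>M|X\<close> lowers size and rank by one each and so
    preserves the nullity, against minimality.\<close>
  have cyc: "r (X - {e}) = r X" if e: "e \<in> X" for e
  proof (rule ccontr)
    assume "r (X - {e}) \<noteq> r X"
    moreover have "r X \<le> Suc (r (X - {e}))"
      using rk_insert_le[of e "X - {e}"] e by (simp add: insert_absorb)
    moreover have "r (X - {e}) \<le> r X" by (rule rk_mono) auto
    moreover have "card X = Suc (card (X - {e}))" using card.remove[OF finX e] .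
    ultimately have "P (X - {e})" using XS by (auto simp: P_def)
    then show False using X(2)[of "X - {e}"] \<open>card X = _\<close> by simp
  qed
  define F where "F = {e \<in> E. r (insert e X) = r X}"
  have F: "X \<subseteq> F" "r F = r X" "flat M F"
    using flat_closure[of X] XS S by (auto simp: F_def)
  \<comment> \<open>\<open>X - {e}\<close> still spans \<open>F\<close>, whether or not
    \<open>e\<close> is in \<open>X\<close>.\<close>
  have "r (F - {e}) = r F" if "e \<in> F" for e
  proof -
    have "r X = r (X - {e})" using cyc[of e] by (cases "e \<in> X") auto
    also have "\<dots> \<le> r (F - {e})" using F by (intro rk_mono) auto
    finally show ?thesis using rk_mono[of "F - {e}" F] F by auto
  qed
  moreover have "card X \<le> card (S \<inter> F)" using XS F finS by (intro card_mono) auto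
  moreover have "card (S - F) \<le> card (S - X)" using F finS by (intro card_mono) auto
  moreover have "card S = card X + card (S - X)"
    using XS finX finS by (metis card_Diff_subset card_mono le_add_diff_inverse)
  moreover have "F \<noteq> {}" using rX F by auto
  ultimately show ?thesis using that[of F] F XS S rX by simp
qed

end

section \<open>Rank-deficient sets\<close>

lemma direct_sum_indepI:
  "I \<in> indeps M \<Longrightarrow> J \<in> indeps N \<Longrightarrow> I \<union> J \<in> indeps (direct_sum M N)"
  by (auto simp: direct_sum_def)

text \<open>A larger independent set is larger within one of the summands, and augmentation happens
  there.\<close>

lemma is_matroid_direct_sum:
  assumes "is_matroid M" "is_matroid N" "ground M \<inter> ground N = {}"
  shows "is_matroid (direct_sum M N)"
proof -
  interpret M: matroid M by standard fact
  interpret N: matroid N by standard fact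
  have "\<exists>e\<in>K' - K. insert e K \<in> indeps (direct_sum M N)"
    if K: "K \<in> indeps (direct_sum M N)" "K' \<in> indeps (direct_sum M N)" "card K < card K'" for K K'
  proof -
    obtain I J where IJ: "I \<in> indeps M" "J \<in> indeps N" "K = I \<union> J"
      using K(1) by (auto simp: direct_sum_def)
    obtain I' J' where IJ': "I' \<in> indeps M" "J' \<in> indeps N" "K' = I' \<union> J'"
      using K(2) by (auto simp: direct_sum_def)
    have "I \<inter> J = {}"
      using IJ assms(3) M.indep_subset_ground N.indep_subset_ground by blast
    then have "card K = card I + card J"
      using IJ M.indep_finite N.indep_finite by (simp add: card_Un_disjoint)
    moreover have "card K' \<le> card I' + card J'" using IJ' card_Un_le by auto
    ultimately consider "card I < card I'" | "card J < card J'" using K(3) by linarith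
    then show ?thesis
    proof cases
      case 1
      then obtain e where e: "e \<in> I' - I" "insert e I \<in> indeps M"
        using M.indep_augment IJ IJ' by blast
      have "e \<notin> J" using e IJ IJ' assms(3) M.indep_subset_ground N.indep_subset_ground by blast
      moreover have "insert e K = insert e I \<union> J" using IJ by auto
      then have "insert e K \<in> indeps (direct_sum M N)"
        using direct_sum_indepI[OF e(2) IJ(2)] by simp
      ultimately show ?thesis using e IJ IJ' by blast
    next
      case 2
      then obtain e where e: "e \<in> J' - J" "insert e J \<in> indeps N"
        using N.indep_augment IJ IJ' by blast
      have "e \<notin> I" using e IJ IJ' assms(3) M.indep_subset_ground N.indep_subset_ground by blast
      moreover have "insert e K = I \<union> insert e J" using IJ by auto
      then have "insert e K \<in> indeps (direct_sum M N)"
        using direct_sum_indepI[OF IJ(1) e(2)] by simp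
      ultimately show ?thesis using e IJ IJ' by blast
    qed
  qed
  moreover have "K' \<in> indeps (direct_sum M N)" if K: "K \<in> indeps (direct_sum M N)" "K' \<subseteq> K" for K K'
  proof -
    obtain I J where IJ: "I \<in> indeps M" "J \<in> indeps N" "K = I \<union> J"
      using K(1) by (auto simp: direct_sum_def)
    have "K' = (K' \<inter> I) \<union> (K' \<inter> J)" using IJ K by auto
    moreover have "K' \<inter> I \<in> indeps M" "K' \<inter> J \<in> indeps N"
      using IJ M.indep_mono N.indep_mono by auto
    ultimately show ?thesis unfolding direct_sum_def by auto
  qed
  moreover have "{} \<in> indeps (direct_sum M N)" "finite (ground (direct_sum M N))"
    "\<forall>K\<in>indeps (direct_sum M N). K \<subseteq> ground (direct_sum M N)"
    using M.indep_subset_ground N.indep_subset_ground by (fastforce simp: direct_sum_def)+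
  ultimately show ?thesis unfolding is_matroid_def by blast
qed

lemma direct_sum_commute: "direct_sum M N = direct_sum N M"
  unfolding direct_sum_def by (auto simp: Un_commute)

text \<open>For stressed \<open>A\<close>, the sets whose rank deficit relative to the uniform matroid is due to \<open>A\<close>.\<close>

definition deficient_sets :: "'a matroid \<Rightarrow> 'a set \<Rightarrow> 'a set set" where
  "deficient_sets M A =
     {S. S \<subseteq> ground M \<and> rk M A < card (S \<inter> A) \<and> card (S - A) < rank M - rk M A}"

text \<open>Here \<open>M|A\<close> and \<open>M/A\<close> are the two uniform summands. As
  \<open>S\<close> overfills \<open>A\<close> but does not span \<open>M\<close>, it has fewer than
  \<open>q\<close> elements in \<open>B\<close>.\<close>

lemma deficient_direct_sum_uniform:
  fixes A B :: "'a set"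
  assumes fin: "finite A" "finite B" and disj: "A \<inter> B = {}"
    and le: "p \<le> card A" "q \<le> card B"
    and M: "M = direct_sum (uniform_on p A) (uniform_on q B)"
    and S: "S \<subseteq> ground M" "rk M S < rank M" "p < card (S \<inter> A)"
  shows "stressed M A \<and> S \<in> deficient_sets M A"
proof -
  have m: "is_matroid (uniform_on p A)" "is_matroid (uniform_on q B)"
    using fin is_matroid_uniform_on by auto
  have g: "ground (uniform_on p A) = A" "ground (uniform_on q B) = B" "ground M = A \<union> B"
    by (auto simp: uniform_on_def M direct_sum_def)
  interpret matroid M
    by standard (use is_matroid_direct_sum[OF m] g disj M in simp)
  have rk: "r X = min (card (X \<inter> A)) p + min (card (X \<inter> B)) q" for X
    using rk_direct_sum[OF m, of X] g disj fin by (simp add: M rk_uniform_on)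
  have "A \<inter> A = A" "B \<inter> B = B" "(A \<union> B) \<inter> A = A" "(A \<union> B) \<inter> B = B" by auto
  then have rA: "r A = p" and rM: "rank M = p + q"
    using rk[of A] rk[of "A \<union> B"] disj le by (auto simp: rank_def g)
  have "r X = min (card X) p" if "X \<subseteq> A" for X
  proof -
    have "X \<inter> A = X" "X \<inter> B = {}" using that disj by auto
    then show ?thesis by (simp add: rk)
  qed
  moreover have "r (X \<union> A) = p + min (card X) q" if "X \<subseteq> ground M - A" for X
  proof -
    have "(X \<union> A) \<inter> A = A" "(X \<union> A) \<inter> B = X" using that disj g by auto
    then show ?thesis using le by (simp add: rk)
  qed
  ultimately have "stressed M A" unfolding stressed_iff by (simp add: rA rM g)
  moreover have "S - A = S \<inter> B" using S disj g by auto
  then have "card (S - A) < q" using S rk[of S] rM by (simp add: min_def split: if_splits)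
  ultimately show ?thesis using S rA rM by (simp add: deficient_sets_def)
qed

lemma elementary_split_is_matroid: "elementary_split M \<Longrightarrow> is_matroid M"
  unfolding elementary_split_def connected_split_def uniform_def
  using is_matroid_direct_sum by auto

text \<open>In the connected split case \<open>A\<close> is the cyclic flat extracted from
  \<open>S\<close>; in a direct sum it is the ground set of a summand that \<open>S\<close>
  overfills.\<close>

lemma elementary_split_deficient:
  assumes "elementary_split M" and S: "S \<subseteq> ground M" "rk M S < rank M" "rk M S < card S"
  obtains A where "stressed M A" "S \<in> deficient_sets M A"
proof -
  consider "connected_split M"
    | M1 M2 where "uniform M1" "uniform M2" "ground M1 \<inter> ground M2 = {}" "M = direct_sum M1 M2"
    using assms(1) unfolding elementary_split_def by blast
  then show ?thesis
  proof cases
    case 1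
    then interpret matroid M by unfold_locales (simp add: connected_split_def)
    interpret split_matroid M
      by unfold_locales
        (use 1 connected_imp_minor_connected in \<open>auto simp: connected_split_def\<close>)
    obtain F where "flat M F" "F \<noteq> {}" "\<And>e. e \<in> F \<Longrightarrow> r (F - {e}) = r F"
      "r F < card (S \<inter> F)" "card (S - F) < rank M - r F"
      using cyclic_flat_of_deficient[OF S] by blast
    then show ?thesis
      using S(1) that[of F] cyclic_flat_stressed[of F] by (simp add: deficient_sets_def)
  next
    case 2
    define A B where "A = ground M1" and "B = ground M2"
    have fin: "finite A" "finite B" and disj: "A \<inter> B = {}"
      using 2 by (auto simp: uniform_def is_matroid_def A_def B_def)
    obtain p where p: "p \<le> card A" "M1 = uniform_on p A"
      using 2(1) unfolding uniform_def A_def by blast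
    obtain q where q: "q \<le> card B" "M2 = uniform_on q B"
      using 2(2) unfolding uniform_def B_def by blast
    have M: "M = direct_sum (uniform_on p A) (uniform_on q B)" using 2 p q by simp
    have "rk M S = rk M1 (S \<inter> A) + rk M2 (S \<inter> B)"
      unfolding A_def B_def 2(4) using 2(1-3) by (intro rk_direct_sum) (auto simp: uniform_def)
    then have rS: "rk M S = min (card (S \<inter> A)) p + min (card (S \<inter> B)) q"
      using fin by (simp add: p q rk_uniform_on)
    have SAB: "S = (S \<inter> A) \<union> (S \<inter> B)"
      using S(1) by (auto simp: M direct_sum_def uniform_on_def)
    have "card S \<le> card (S \<inter> A) + card (S \<inter> B)"
      by (subst SAB) (rule card_Un_le)
    then have "p < card (S \<inter> A) \<or> q < card (S \<inter> B)" using S(3) rS by (simp add: min_def split: if_splits)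
    then show ?thesis
    proof
      assume "p < card (S \<inter> A)"
      then show ?thesis
        using deficient_direct_sum_uniform[OF fin disj p(1) q(1) M S(1,2)] that by blast
    next
      assume "q < card (S \<inter> B)"
      \<comment> \<open>The same lemma with the two summands exchanged.\<close>
      then show ?thesis
        using deficient_direct_sum_uniform[OF fin(2,1) _ q(1) p(1) _ S(1,2)] disj M that
        by (metis Int_commute direct_sum_commute)
    qed
  qed
qed

section \<open>Uniqueness of the stressed set behind a rank deficit\<close>

context matroid
begin

lemma rk_deficient:
  assumes "stressed M A" "S \<in> deficient_sets M A"
  shows "r S = r A + card (S - A)"
  using rk_stressed[OF assms(1), of S] assms(2) by (auto simp: deficient_sets_def)

text \<open>\<open>S \<inter> A\<close> consists of the elements of \<open>S\<close> that are not coloops of \<open>M|S\<close>, and \<open>A\<close> is its closure.\<close>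

lemma deficient_sets_unique:
  assumes "stressed M A" "S \<in> deficient_sets M A" "stressed M B" "S \<in> deficient_sets M B"
  shows "A = B"
proof -
  have S: "S \<subseteq> E" using assms(2) by (simp add: deficient_sets_def)
  have finS: "finite S" using S finite_ground by (rule finite_subset)
  have core: "S \<inter> A = {e \<in> S. r (S - {e}) = r S}"
    if A: "stressed M A" "S \<in> deficient_sets M A" for A
  proof -
    have D: "r A < card (S \<inter> A)" "card (S - A) < rank M - r A"
      using A(2) by (auto simp: deficient_sets_def)
    have "r (S - {e}) = r S \<longleftrightarrow> e \<in> A" if e: "e \<in> S" for e
    proof (cases "e \<in> A")
      case True
      have *: "(S - {e}) \<inter> A = S \<inter> A - {e}" "S - {e} - A = S - A" using True by auto
      \<comment> \<open>\<open>S \<inter> A\<close> has more than \<open>r A\<close> elements, so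
        after losing one \<open>rk_stressed\<close> still applies.\<close>
      have "r A \<le> card ((S - {e}) \<inter> A)" using True e D(1) finS by (simp add: *(1) card_Diff_singleton)
      then have "r (S - {e}) = r A + min (card (S - {e} - A)) (rank M - r A)"
        using S by (intro rk_stressed[OF A(1)]) auto
      then have "r (S - {e}) = r A + card (S - A)" using D(2) by (simp only: *(2))
      then show ?thesis using True rk_deficient[OF A] by simp
    next
      case False
      have *: "(S - {e}) \<inter> A = S \<inter> A" "S - {e} - A = S - A - {e}" using False by auto
      have c: "card (S - A) = Suc (card (S - A - {e}))"
        using False e finS by (intro card.remove) auto
      \<comment> \<open>Elements of \<open>S\<close> outside \<open>A\<close> count fully towards
        the rank, so deleting \<open>e\<close> lowers it by one.\<close>
      have "r (S - {e}) = r A + min (card (S - {e} - A)) (rank M - r A)"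
        by (rule rk_stressed[OF A(1)]) (use S D *(1) in auto)
      then have "r (S - {e}) = r A + min (card (S - A - {e})) (rank M - r A)"
        by (simp only: *(2))
      then show ?thesis using False rk_deficient[OF A] c D by simp
    qed
    then show ?thesis by auto
  qed
  have closure: "A = {e \<in> E. r (insert e (S \<inter> A)) = r (S \<inter> A)}"
    if A: "stressed M A" "S \<in> deficient_sets M A" for A
  proof -
    have D: "r A < card (S \<inter> A)" "card (S - A) < rank M - r A" and AE: "A \<subseteq> E"
      using A by (auto simp: deficient_sets_def stressed_def)
    have SA: "S \<inter> A \<inter> A = S \<inter> A" "S \<inter> A - A = {}" by auto
    have rSA: "r (S \<inter> A) = r A"
      using rk_stressed[OF A(1), of "S \<inter> A"] D S unfolding SA by auto
    have "r (insert e (S \<inter> A)) = r (S \<inter> A) \<longleftrightarrow> e \<in> A" if e: "e \<in> E" for e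
    proof (cases "e \<in> A")
      case True
      have "r (insert e (S \<inter> A)) \<le> r A" using True by (intro rk_mono) auto
      moreover have "r (S \<inter> A) \<le> r (insert e (S \<inter> A))" by (intro rk_mono) auto
      ultimately show ?thesis using True rSA by auto
    next
      case False
      have *: "insert e (S \<inter> A) \<inter> A = S \<inter> A" "insert e (S \<inter> A) - A = {e}" using False by auto
      \<comment> \<open>The second bound in \<open>D\<close> makes \<open>rank M - r A\<close>
        positive, so an element outside \<open>A\<close> raises the rank.\<close>
      have "r (insert e (S \<inter> A)) = r A + min 1 (rank M - r A)"
        using rk_stressed[OF A(1), of "insert e (S \<inter> A)"] e S D unfolding * by auto
      then show ?thesis using False rSA D by auto
    qed
    then show ?thesis using AE by auto
  qed
  have "S \<inter> A = S \<inter> B" using core[OF assms(1,2)] core[OF assms(3,4)] by simp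
  then show ?thesis using closure[OF assms(1,2)] closure[OF assms(3,4)] by simp
qed

text \<open>Ensures that every stressed set causing a deficit is counted by
  \<open>stressed_count\<close>: pad \<open>r A + 1\<close> elements of \<open>S \<inter> A\<close>
  to a set of size \<open>rank M\<close>.\<close>

lemma deficient_imp_cover_nonempty:
  assumes "S \<in> deficient_sets M A" "A \<subseteq> E"
  shows "cover M A \<noteq> {}"
proof -
  have D: "S \<subseteq> E" "Suc (r A) \<le> card (S \<inter> A)" "Suc (r A) \<le> rank M"
    using assms by (auto simp: deficient_sets_def)
  obtain Y where Y: "Y \<subseteq> S \<inter> A" "card Y = Suc (r A)"
    using D(2) by (meson obtain_subset_with_card_n)
  have "rank M \<le> card E" by (simp add: rank_def rk_le_card)
  then obtain Z where Z: "Y \<subseteq> Z" "Z \<subseteq> E" "card Z = rank M"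
    using exists_subset_between[of Y "rank M" E] Y D by auto
  have "finite Z" using Z(2) finite_ground by (rule finite_subset)
  then have "card Y \<le> card (Z \<inter> A)" using Y Z by (intro card_mono) auto
  then show ?thesis using Y Z by (auto simp: cover_def)
qed

end

section \<open>The Tutte polynomial\<close>

lemma sum_Pow_card:
  fixes f :: "nat \<Rightarrow> 'b :: comm_semiring_1"
  assumes "finite A"
  shows "(\<Sum>P\<in>Pow A. f (card P)) = (\<Sum>i = 0..card A. of_nat (card A choose i) * f i)"
proof -
  have "(\<Sum>P\<in>Pow A. f (card P)) = (\<Sum>i = 0..card A. \<Sum>P\<in>{P \<in> Pow A. card P = i}. f (card P))"
    by (rule sum.group[symmetric]) (use assms in \<open>auto intro: card_mono\<close>)
  also have "\<dots> = (\<Sum>i = 0..card A. \<Sum>P\<in>{P \<in> Pow A. card P = i}. f i)"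
    by (intro sum.cong) auto
  also have "\<dots> = (\<Sum>i = 0..card A. of_nat (card A choose i) * f i)"
    using n_subsets[OF assms] by (simp add: Pow_def)
  finally show ?thesis .
qed

text \<open>A subset corresponds to the pair of its parts inside and outside
  \<open>A\<close>.\<close>

lemma sum_Pow_split_card:
  fixes f :: "nat \<Rightarrow> nat \<Rightarrow> 'b :: comm_semiring_1"
  assumes "finite E" "A \<subseteq> E"
  shows "(\<Sum>S\<in>Pow E. f (card (S \<inter> A)) (card (S - A))) =
    (\<Sum>i = 0..card A. \<Sum>j = 0..card (E - A).
      of_nat (card A choose i) * of_nat (card (E - A) choose j) * f i j)"
proof -
  have "(\<Sum>S\<in>Pow E. f (card (S \<inter> A)) (card (S - A))) =
      (\<Sum>(P, Q)\<in>Pow A \<times> Pow (E - A). f (card P) (card Q))"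
    by (rule sum.reindex_bij_witness[of _ "\<lambda>(P, Q). P \<union> Q" "\<lambda>S. (S \<inter> A, S - A)"])
      (use assms(2) in \<open>auto intro!: arg_cong2[of _ _ _ _ "\<lambda>P Q. f (card P) (card Q)"]\<close>)
  also have "\<dots> = (\<Sum>P\<in>Pow A. \<Sum>Q\<in>Pow (E - A). f (card P) (card Q))"
    by (rule sum.cartesian_product[symmetric])
  also have "\<dots> = (\<Sum>P\<in>Pow A. \<Sum>j = 0..card (E - A). of_nat (card (E - A) choose j) * f (card P) j)"
    using assms by (intro sum.cong refl sum_Pow_card) auto
  also have "\<dots> = (\<Sum>i = 0..card A. of_nat (card A choose i) *
      (\<Sum>j = 0..card (E - A). of_nat (card (E - A) choose j) * f i j))"
    using assms by (intro sum_Pow_card) (rule finite_subset)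
  finally show ?thesis by (simp add: sum_distrib_left mult.assoc)
qed

text \<open>The contribution of a set of rank \<open>q\<close> and size \<open>c\<close> in a
  matroid of rank \<open>k\<close>.\<close>

definition tutte_term :: "nat \<Rightarrow> nat \<Rightarrow> nat \<Rightarrow> int poly poly" where
  "tutte_term k q c = (var_x - 1) ^ (k - q) * (var_y - 1) ^ (c - q)"

text \<open>Uniform contribution minus actual contribution of a deficient set with \<open>i\<close>
  elements in the stressed set and \<open>j\<close> outside. Of the excess \<open>d\<close> and the
  remaining room \<open>e\<close>, the smaller is the exponent of the product in
  \<open>alpha\<close>.\<close>

lemma alpha_eq:
  assumes "q < i" "j < k - q"
  shows "alpha q k i j = tutte_term k (min (i + j) k) (i + j) - tutte_term k (q + j) (i + j)"
proof -
  have eq: "x ^ a * (1 - (x * y) ^ d) = x ^ a - x ^ (a + d) * y ^ d"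
    for x y :: "int poly poly" and a d
    by (simp add: right_diff_distrib power_add power_mult_distrib mult.assoc)
  define d e where "d = i - q" and "e = k - q - j"
  have ik: "i = q + d" "k = q + j + e" using assms by (simp_all add: d_def e_def)
  show ?thesis
  proof (cases "d \<le> e")
    case True
    then show ?thesis
      using eq[of "var_x - 1" "e - d" "var_y - 1" d] by (simp add: ik alpha_def tutte_term_def)
  next
    case False
    \<comment> \<open>The same identity with the two variables exchanged.\<close>
    then show ?thesis
      using eq[of "var_y - 1" "d - e" "var_x - 1" e]
      by (simp add: ik alpha_def tutte_term_def mult.commute)
  qed
qed

lemma tutte_U:
  assumes "k \<le> n"
  shows "tutte (U k n) = (\<Sum>i = 0..n. of_nat (n choose i) * tutte_term k (min i k) i)"
proof -
  have "ground (U k n) = {..<n}" by (simp add: U_def uniform_on_def)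
  moreover have "rk (U k n) S = min (card S) k" if "S \<subseteq> {..<n}" for S
    using that by (simp add: U_def rk_uniform_on)
  \<comment> \<open>By \<open>k \<le> n\<close> the ground set has rank exactly
    \<open>k\<close>.\<close>
  ultimately have "tutte (U k n) = (\<Sum>S\<in>Pow {..<n}. tutte_term k (min (card S) k) (card S))"
    unfolding tutte_def tutte_term_def using assms by (intro sum.cong) auto
  then show ?thesis
    using sum_Pow_card[of "{..<n}" "\<lambda>i. tutte_term k (min i k) i"] by simp
qed

lemma (in matroid) sum_deficient_sets:
  assumes A: "A \<subseteq> E"
  shows "(\<Sum>S\<in>Pow E. if S \<in> deficient_sets M A then f (card (S \<inter> A)) (card (S - A)) else 0) =
    (\<Sum>i = r A + 1..card A. \<Sum>j = 0..<rank M - r A.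
      of_nat (card A choose i) * of_nat ((card E - card A) choose j) * (f i j :: 'b :: comm_semiring_1))"
proof -
  let ?g = "\<lambda>i j. if r A < i \<and> j < rank M - r A then f i j else 0"
  have finA: "finite A" using A finite_ground by (rule finite_subset)
  have c: "card (E - A) = card E - card A" using A finA by (rule card_Diff_subset[rotated])
  have "(\<Sum>S\<in>Pow E. if S \<in> deficient_sets M A then f (card (S \<inter> A)) (card (S - A)) else 0) =
      (\<Sum>S\<in>Pow E. ?g (card (S \<inter> A)) (card (S - A)))"
    by (intro sum.cong) (auto simp: deficient_sets_def)
  also have "\<dots> = (\<Sum>i = 0..card A. \<Sum>j = 0..card E - card A.
      of_nat (card A choose i) * of_nat ((card E - card A) choose j) * ?g i j)"
    using sum_Pow_split_card[OF finite_ground A, of ?g] by (simp only: c)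
  also have "\<dots> = (\<Sum>i = r A + 1..card A. \<Sum>j = 0..card E - card A.
      of_nat (card A choose i) * of_nat ((card E - card A) choose j) * ?g i j)"
    by (intro sum.mono_neutral_right) auto
  \<comment> \<open>Neither range of \<open>j\<close> need contain the other: surplus terms vanish
    by the condition in \<open>?g\<close> on the left and by a zero binomial on the right.\<close>
  also have "\<dots> = (\<Sum>i = r A + 1..card A. \<Sum>j = 0..<rank M - r A.
      of_nat (card A choose i) * of_nat ((card E - card A) choose j) * f i j)"
    by (intro sum.cong refl sum.mono_neutral_cong) (auto simp: binomial_eq_0)
  finally show ?thesis .
qed

theorem theorem7p20:
  fixes M :: "'a matroid" and k n :: nat
  assumes "elementary_split M"
    and "rank M = k"
    and "card (ground M) = n"
  shows "tutte M = tutte (U k n) -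
    (\<Sum>r = 0..k. \<Sum>h = 0..n. of_nat (stressed_count M r h) *
      (\<Sum>i = r + 1..h. \<Sum>j = 0..<k - r.
        of_nat (h choose i) * of_nat ((n - h) choose j) * alpha r k i j))"
proof -
  interpret matroid M by unfold_locales (rule elementary_split_is_matroid[OF assms(1)])
  define L where "L = {A. stressed M A \<and> cover M A \<noteq> {}}"
  define u where "u c = tutte_term k (min c k) c" for c
  define g where "g q h = (\<Sum>i = q + 1..h. \<Sum>j = 0..<k - q.
    of_nat (h choose i) * of_nat ((n - h) choose j) * alpha q k i j)" for q h
  have L_sub: "L \<subseteq> Pow E" by (auto simp: L_def stressed_def)
  have finL: "finite L" using L_sub by (rule finite_subset) simp
  have kn: "k \<le> n" using assms rk_le_card[of E] by (simp add: rank_def)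
  \<comment> \<open>\<open>U k n\<close> has another ground set, but its sum depends only on
    cardinalities and so can be taken over subsets of \<open>E\<close>.\<close>
  have unif: "tutte (U k n) = (\<Sum>S\<in>Pow E. u (card S))"
    using tutte_U[OF kn] sum_Pow_card[OF finite_ground, of u] assms(3) by (simp add: u_def)
  \<comment> \<open>The sum over \<open>L\<close> has exactly one active summand if \<open>S\<close>
    is deficient, by existence and uniqueness of the stressed set, and none otherwise.\<close>
  have pointwise: "tutte_term k (r S) (card S) = u (card S) -
      (\<Sum>A\<in>L. if S \<in> deficient_sets M A then alpha (r A) k (card (S \<inter> A)) (card (S - A)) else 0)"
    if S: "S \<subseteq> E" for S
  proof (cases "r S < k \<and> r S < card S")
    case True
    obtain A where A: "stressed M A" "S \<in> deficient_sets M A"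
      using elementary_split_deficient[OF assms(1) S] True assms(2) by blast
    have AE: "A \<subseteq> E" using A by (simp add: stressed_def)
    have AL: "A \<in> L" using A AE deficient_imp_cover_nonempty by (auto simp: L_def)
    have "S \<in> deficient_sets M B \<longleftrightarrow> B = A" if "B \<in> L" for B
      using that A deficient_sets_unique by (auto simp: L_def)
    then have "(\<Sum>B\<in>L. if S \<in> deficient_sets M B then alpha (r B) k (card (S \<inter> B)) (card (S - B)) else 0) =
        (\<Sum>B\<in>L. if B = A then alpha (r B) k (card (S \<inter> B)) (card (S - B)) else 0)"
      by (intro sum.cong) auto
    also have "\<dots> = alpha (r A) k (card (S \<inter> A)) (card (S - A))"
      using AL finL by simp
    also have "\<dots> = u (card S) - tutte_term k (r S) (card S)"
    proof -
      have "finite S" using S finite_ground by (rule finite_subset)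
      then have "card S = card (S \<inter> A) + card (S - A)" by (metis card_Int_Diff)
      then show ?thesis
        using alpha_eq A(2) rk_deficient[OF A] assms(2) by (simp add: u_def deficient_sets_def)
    qed
    finally show ?thesis by simp
  next
    case False
    have "finite S" using S finite_ground by (rule finite_subset)
    then have "r S = min (card S) k"
      using False rk_le_card[of S] rk_mono[OF S] assms(2) by (auto simp: rank_def)
    \<comment> \<open>Membership would put \<open>r S\<close> below both \<open>k\<close> and
      \<open>card S\<close>.\<close>
    moreover have "S \<notin> deficient_sets M A" if "A \<in> L" for A
    proof
      assume D: "S \<in> deficient_sets M A"
      have "r S = r A + card (S - A)" using that D by (intro rk_deficient) (auto simp: L_def)
      moreover have "card S = card (S \<inter> A) + card (S - A)"
        using \<open>finite S\<close> by (metis card_Int_Diff)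
      ultimately show False using D False assms(2) by (auto simp: deficient_sets_def)
    qed
    ultimately show ?thesis by (simp add: u_def)
  qed
  have "tutte M = (\<Sum>S\<in>Pow E. tutte_term k (r S) (card S))"
    using assms(2) by (simp add: tutte_def tutte_term_def rank_def)
  also have "\<dots> = tutte (U k n) - (\<Sum>S\<in>Pow E. \<Sum>A\<in>L.
      if S \<in> deficient_sets M A then alpha (r A) k (card (S \<inter> A)) (card (S - A)) else 0)"
    unfolding unif sum_subtractf[symmetric] by (intro sum.cong pointwise) auto
  \<comment> \<open>Exchange the sums: for fixed \<open>A\<close>, summing over its deficient sets
    gives a value depending only on rank and size of \<open>A\<close>.\<close>
  also have "(\<Sum>S\<in>Pow E. \<Sum>A\<in>L.
      if S \<in> deficient_sets M A then alpha (r A) k (card (S \<inter> A)) (card (S - A)) else 0) =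
      (\<Sum>A\<in>L. g (r A) (card A))"
    unfolding g_def by (subst sum.swap, intro sum.cong refl)
      (use L_sub in \<open>subst sum_deficient_sets, auto simp: assms\<close>)
  \<comment> \<open>Grouping \<open>L\<close> by rank and size turns the sum over stressed sets into
    one weighted by \<open>stressed_count\<close>.\<close>
  also have "\<dots> = (\<Sum>(q, h)\<in>{0..k} \<times> {0..n}. \<Sum>A\<in>{A \<in> L. (r A, card A) = (q, h)}. g (r A) (card A))"
  proof -
    have "(\<lambda>A. (r A, card A)) ` L \<subseteq> {0..k} \<times> {0..n}"
      using L_sub rk_mono[of _ E] card_mono[OF finite_ground] assms by (auto simp: rank_def)
    then have "(\<Sum>p\<in>{0..k} \<times> {0..n}. \<Sum>A\<in>{A \<in> L. (r A, card A) = p}. g (r A) (card A)) =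
        (\<Sum>A\<in>L. g (r A) (card A))"
      using finL by (intro sum.group) auto
    then show ?thesis by (simp only: case_prod_unfold prod.collapse)
  qed
  also have "\<dots> = (\<Sum>(q, h)\<in>{0..k} \<times> {0..n}. of_nat (stressed_count M q h) * g q h)"
    by (intro sum.cong) (auto simp: stressed_count_def L_def)
  finally show ?thesis by (simp add: g_def sum.cartesian_product)
qed

end
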